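(* Let $\mathcal{L}$ be a $4$-dimensional solvable Leibniz algebra over $\mathbb{C}$ whose nilradical is isomorphic to the $3$-dimensional algebra $\lambda_6:\ [e_1,e_1]=e_2,\ [e_2,e_1]=e_3$. Then $\mathcal{L}$ is isomorphic to the following algebra with basis $\{x,e_1,e_2,e_3\}$: $$\mathcal{L}_{43}:\ [e_1,e_1]=e_2,\ [e_2,e_1]=e_3,\ [e_1,x]=e_1,\ [e_2,x]=2e_2,\ [e_3,x]=3e_3,\ [x,e_1]=-e_1.$$
   Context: A (right) Leibniz algebra over $\mathbb{C}$ is a $\mathbb{C}$-vector space $\mathcal{L}$ with a bilinear bracket $[-,-]:\mathcal{L}\times\mathcal{L}\to\mathcal{L}$ satisfying $[x,[y,z]]=[[x,y],z]-[[x,z],y]$ for all $x,y,z\in\mathcal{L}$. All algebras are finite-dimensional over $\mathbb{C}$. Define $\mathcal{L}^1=\mathcal{L}$, $\mathcal{L}^{k+1}=[\mathcal{L}^k,\mathcal{L}]$ and $\mathcal{L}^{[1]}=\mathcal{L}$, $\mathcal{L}^{[s+1]}=[\mathcal{L}^{[s]},\mathcal{L}^{[s]}]$; $\mathcal{L}$ is nilpotent (resp. solvable) if $\mathcal{L}^n=0$ for some $n$ (resp. $\mathcal{L}^{[m]}=0$ for some $m$). The nilradical of $\mathcal{L}$ is its maximal nilpotent (two-sided) ideal. In multiplication tables, products of basis elements that are not listed are zero. *)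

theory Defs
  imports "HOL-Analysis.Analysis"
begin

text \<open>Finite-dimensionality is not part of the locale; it is imposed through \<open>dim\<close>
  where it is needed.\<close>

locale leibniz_algebra = vector_space scale
  for scale :: "complex \<Rightarrow> 'a::ab_group_add \<Rightarrow> 'a" +
  fixes bracket :: "'a \<Rightarrow> 'a \<Rightarrow> 'a"
  assumes linear_right: "Vector_Spaces.linear scale scale (\<lambda>y. bracket x y)"
    and linear_left: "Vector_Spaces.linear scale scale (\<lambda>x. bracket x y)"
    and leibniz: "bracket x (bracket y z) = bracket (bracket x y) z - bracket (bracket x z) y"
begin

definition bracket_space :: "'a set \<Rightarrow> 'a set \<Rightarrow> 'a set"
  where "bracket_space A B = span {bracket a b | a b. a \<in> A \<and> b \<in> B}"

text \<open>Both series are indexed from \<open>0\<close>: \<open>lower_central A k\<close> is the term usually written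
  \<open>A\<close> with exponent \<open>k + 1\<close>, and likewise for \<open>derived A k\<close>. They are meant for a
  subalgebra \<open>A\<close>, with \<open>A = UNIV\<close> giving the series of the whole algebra.\<close>

primrec lower_central :: "'a set \<Rightarrow> nat \<Rightarrow> 'a set"
  where
    "lower_central A 0 = A"
  | "lower_central A (Suc k) = bracket_space (lower_central A k) A"

primrec derived :: "'a set \<Rightarrow> nat \<Rightarrow> 'a set"
  where
    "derived A 0 = A"
  | "derived A (Suc k) = bracket_space (derived A k) (derived A k)"

definition nilpotent :: "'a set \<Rightarrow> bool"
  where "nilpotent A \<longleftrightarrow> (\<exists>n. lower_central A n = {0})"

definition solvable :: "'a set \<Rightarrow> bool"
  where "solvable A \<longleftrightarrow> (\<exists>n. derived A n = {0})"

definition two_sided_ideal :: "'a set \<Rightarrow> bool"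
  where "two_sided_ideal I \<longleftrightarrow>
    subspace I \<and> (\<forall>a\<in>I. \<forall>x. bracket a x \<in> I \<and> bracket x a \<in> I)"

text \<open>Maximality is with respect to inclusion.\<close>

definition is_nilradical :: "'a set \<Rightarrow> bool"
  where "is_nilradical N \<longleftrightarrow>
    two_sided_ideal N \<and> nilpotent N \<and>
    (\<forall>M. two_sided_ideal M \<and> nilpotent M \<and> N \<subseteq> M \<longrightarrow> M = N)"

end

text \<open>Isomorphism between subalgebras \<open>A\<close> and \<open>B\<close> of two algebras, each with the restricted
  operations; the values of \<open>f\<close> outside \<open>A\<close> are irrelevant.\<close>

definition algebra_isomorphic ::
    "(complex \<Rightarrow> 'a::ab_group_add \<Rightarrow> 'a) \<Rightarrow> ('a \<Rightarrow> 'a \<Rightarrow> 'a) \<Rightarrow> 'a set \<Rightarrow>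
     (complex \<Rightarrow> 'b::ab_group_add \<Rightarrow> 'b) \<Rightarrow> ('b \<Rightarrow> 'b \<Rightarrow> 'b) \<Rightarrow> 'b set \<Rightarrow> bool"
  where "algebra_isomorphic scaleA brA A scaleB brB B \<longleftrightarrow>
    (\<exists>f. bij_betw f A B \<and>
      (\<forall>x\<in>A. \<forall>y\<in>A. f (x + y) = f x + f y) \<and>
      (\<forall>c. \<forall>x\<in>A. f (scaleA c x) = scaleB c (f x)) \<and>
      (\<forall>x\<in>A. \<forall>y\<in>A. f (brA x y) = brB (f x) (f y)))"

text \<open>The bilinear product on coordinate space whose value on the \<open>i\<close>-th and \<open>j\<close>-th
  standard basis vectors is \<open>c i j\<close>.\<close>

definition table_bracket ::
    "('n::finite \<Rightarrow> 'n \<Rightarrow> complex ^ 'n) \<Rightarrow> complex ^ 'n \<Rightarrow> complex ^ 'n \<Rightarrow> complex ^ 'n"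
  where "table_bracket c u v = (\<Sum>i\<in>UNIV. \<Sum>j\<in>UNIV. (u $ i * v $ j) *s c i j)"

abbreviation std_basis :: "'n::finite \<Rightarrow> complex ^ 'n"
  where "std_basis i \<equiv> axis i 1"

definition lambda6_table :: "3 \<Rightarrow> 3 \<Rightarrow> complex ^ 3"
  where "lambda6_table i j =
    (if i = 1 \<and> j = 1 then std_basis 2
     else if i = 2 \<and> j = 1 then std_basis 3
     else 0)"

text \<open>The indices \<open>1, 2, 3\<close> stand for \<open>e\<^sub>1, e\<^sub>2, e\<^sub>3\<close> and the index \<open>4\<close> (which equals \<open>0\<close>
  in the index type) stands for \<open>x\<close>.\<close>

definition L43_table :: "4 \<Rightarrow> 4 \<Rightarrow> complex ^ 4"
  where "L43_table i j =
    (if i = 1 \<and> j = 1 then std_basis 2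
     else if i = 2 \<and> j = 1 then std_basis 3
     else if i = 1 \<and> j = 4 then std_basis 1
     else if i = 2 \<and> j = 4 then 2 *s std_basis 2
     else if i = 3 \<and> j = 4 then 3 *s std_basis 3
     else if i = 4 \<and> j = 1 then - std_basis 1
     else 0)"

definition lambda6_bracket :: "complex ^ 3 \<Rightarrow> complex ^ 3 \<Rightarrow> complex ^ 3"
  where "lambda6_bracket = table_bracket lambda6_table"

definition L43_bracket :: "complex ^ 4 \<Rightarrow> complex ^ 4 \<Rightarrow> complex ^ 4"
  where "L43_bracket = table_bracket L43_table"

end

theory Submission
  imports Defs
begin

text \<open>
  Write \<open>N\<close> for the nilradical, with basis \<open>e\<^sub>1, e\<^sub>2, e\<^sub>3\<close>, and let \<open>x\<close> span a complement. Since
  right multiplications are derivations and \<open>e\<^sub>1\<close> generates \<open>N\<close>, right multiplication by \<open>x\<close> is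
  determined by \<open>[e\<^sub>1, x]\<close>: it is triangular with diagonal \<open>a, 2a, 3a\<close>. In a right Leibniz algebra
  \<open>[y, [z, z]] = 0\<close> and \<open>[y, [z, w]] = - [y, [w, z]]\<close>; hence \<open>x\<close> annihilates \<open>e\<^sub>2\<close> and \<open>e\<^sub>3\<close> from the
  left, \<open>[x, e\<^sub>1]\<close> has leading coefficient \<open>- a\<close>, and \<open>[x, x]\<close> lies in the span of \<open>e\<^sub>2, e\<^sub>3\<close>
  (lemma \<open>action_of_x\<close>).

  If \<open>a = 0\<close>, every product lies in the span of \<open>e\<^sub>2, e\<^sub>3\<close> and the whole algebra is nilpotent
  (lemma \<open>nilpotent_UNIV\<close>), contradicting the maximality of \<open>N\<close>. Otherwise the eigenvalues
  \<open>a, 2a, 3a\<close> are distinct, so \<open>e\<^sub>1\<close> can be replaced by an eigenvector with the same leading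
  coefficient; its left-normed powers are then eigenvectors as well. The Leibniz identity for
  \<open>x, e\<^sub>1, x\<close> forces \<open>[x, e\<^sub>1] + a e\<^sub>1\<close> to be a multiple of \<open>e\<^sub>3\<close> and ties it to \<open>[x, x]\<close>. Elements of
  the span of \<open>e\<^sub>2, e\<^sub>3\<close> act trivially from the right on \<open>N\<close>, so adding a suitable one to \<open>x / a\<close>
  removes this multiple together with \<open>[x, x]\<close> (lemma \<open>adapted_basis\<close>). The coordinate map of the
  resulting basis is the isomorphism sought.
\<close>

section \<open>Coordinates with respect to a finite family\<close>

locale coordinate_space = vector_space scale
  for scale :: "'k::field \<Rightarrow> 'v::ab_group_add \<Rightarrow> 'v"
begin

definition lincomb :: "('n::finite \<Rightarrow> 'v) \<Rightarrow> 'k ^ 'n \<Rightarrow> 'v"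
  where "lincomb b v = (\<Sum>i\<in>UNIV. scale (v $ i) (b i))"

lemma lincomb_add: "lincomb b (u + v) = lincomb b u + lincomb b v"
  by (simp add: lincomb_def scale_left_distrib sum.distrib)

lemma lincomb_scale: "lincomb b (c *s v) = scale c (lincomb b v)"
  by (simp add: lincomb_def scale_sum_right)

lemma lincomb_zero: "lincomb b 0 = 0"
  by (simp add: lincomb_def)

lemma lincomb_minus: "lincomb b (- v) = - lincomb b v"
  by (simp add: lincomb_def sum_negf)

lemma lincomb_sum: "lincomb b (\<Sum>i\<in>A. f i) = (\<Sum>i\<in>A. lincomb b (f i))"
  by (induction A rule: infinite_finite_induct) (simp_all add: lincomb_zero lincomb_add)

lemma lincomb_axis: "lincomb b (axis i 1) = b i"
proof -
  have "lincomb b (axis i 1) = (\<Sum>j\<in>UNIV. if j = i then b j else 0)"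
    unfolding lincomb_def by (intro sum.cong) (auto simp: axis_def)
  then show ?thesis by simp
qed

lemma inj_lincombI:
  assumes "\<And>v. lincomb b v = 0 \<Longrightarrow> v = 0"
  shows "inj (lincomb b)"
proof (rule injI)
  fix u v assume "lincomb b u = lincomb b v"
  then have "lincomb b (u + - v) = 0"
    by (simp only: lincomb_add lincomb_minus) simp
  then have "u + - v = 0" by (rule assms)
  then show "u = v" by simp
qed

lemma inj_lincomb_imp_inj:
  assumes "inj (lincomb b)"
  shows "inj b"
proof (rule injI)
  fix i j assume "b i = b j"
  then have "lincomb b (axis i 1) = lincomb b (axis j 1)" by (simp add: lincomb_axis)
  then have "axis i (1::'k) = axis j 1" using assms by (simp add: inj_eq)
  then show "i = j" by (simp add: axis_eq_axis)
qed

lemma inj_lincomb_imp_independent: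
  assumes "inj (lincomb b)"
  shows "independent (range b)"
proof
  assume "dependent (range b)"
  then obtain u w where w: "w \<in> range b" "u w \<noteq> 0" and s: "(\<Sum>v\<in>range b. scale (u v) v) = 0"
    by (auto simp: dependent_finite)
  have "lincomb b (\<chi> i. u (b i)) = (\<Sum>v\<in>range b. scale (u v) v)"
    by (simp add: lincomb_def sum.reindex[OF inj_lincomb_imp_inj[OF assms]])
  then have "lincomb b (\<chi> i. u (b i)) = lincomb b 0" using s by (simp add: lincomb_zero)
  then have "(\<chi> i. u (b i)) = 0" using assms by (simp add: inj_eq)
  then show False using w by (auto simp: vec_eq_iff)
qed

lemma range_lincomb:
  assumes "inj b"
  shows "range (lincomb b) = span (range b)"
proof
  show "range (lincomb b) \<subseteq> span (range b)"
    unfolding lincomb_def by (intro image_subsetI span_sum span_scale span_base rangeI)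
  show "span (range b) \<subseteq> range (lincomb b)"
  proof
    fix y assume "y \<in> span (range b)"
    then obtain u where "y = (\<Sum>v\<in>range b. scale (u v) v)" by (auto simp: span_finite)
    then have "y = lincomb b (\<chi> i. u (b i))"
      by (simp add: lincomb_def sum.reindex[OF assms])
    then show "y \<in> range (lincomb b)" by blast
  qed
qed

text \<open>The locale of vector spaces does not presuppose finite dimension, and \<open>dim\<close> is \<open>0\<close> on an
  infinite-dimensional space; positivity of \<open>dim\<close> is what provides a finite basis here.\<close>

lemma span_eq_UNIV:
  assumes S: "finite S" "independent S" and card: "card S = dim UNIV" and pos: "0 < dim UNIV"
  shows "span S = UNIV"
proof -
  obtain B where B: "independent B" "span B = UNIV" "card B = dim UNIV"
    by (rule basis_exists[of UNIV]) blast
  then have "finite B" using pos by (intro card_ge_0_finite) simp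
  have "y \<in> span S" for y
  proof (rule ccontr)
    assume y: "y \<notin> span S"
    then have "independent (insert y S)" using S by (simp add: independent_insert)
    moreover have "insert y S \<subseteq> span B" using B by simp
    ultimately have "card (insert y S) \<le> card B"
      using independent_span_bound[OF \<open>finite B\<close>] by blast
    moreover have "y \<notin> S" using y span_base by blast
    ultimately show False using B S card by simp
  qed
  then show ?thesis by blast
qed

lemma bij_lincomb:
  fixes b :: "'n::finite \<Rightarrow> 'v"
  assumes "inj (lincomb b)" and "dim UNIV = CARD('n)"
  shows "bij (lincomb b)"
proof -
  have b: "inj b" "independent (range b)"
    using assms(1) by (rule inj_lincomb_imp_inj, rule inj_lincomb_imp_independent)
  have "span (range b) = UNIV"
    using b assms(2) by (intro span_eq_UNIV) (simp_all add: card_image)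
  then show ?thesis using assms range_lincomb[OF b(1)] by (simp add: bij_def)
qed

lemma ex_scale_add_range_lincomb:
  fixes b :: "'n::finite \<Rightarrow> 'v"
  assumes inj: "inj (lincomb b)" and dim: "dim UNIV = Suc CARD('n)"
    and x: "x \<notin> range (lincomb b)"
  shows "\<exists>t. \<exists>n\<in>range (lincomb b). y = scale t x + n"
proof -
  have b: "inj b" "independent (range b)"
    using inj by (rule inj_lincomb_imp_inj, rule inj_lincomb_imp_independent)
  have x: "x \<notin> span (range b)" using x range_lincomb[OF b(1)] by simp
  moreover have "x \<notin> range b" using x span_base by blast
  ultimately have "span (insert x (range b)) = UNIV"
    using b dim by (intro span_eq_UNIV) (simp_all add: independent_insert card_image)
  then obtain t where "y - scale t x \<in> range (lincomb b)"
    using span_breakdown_eq[of y x "range b"] range_lincomb[OF b(1)] by auto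
  then show ?thesis by (intro exI[of _ t] bexI[of _ "y - scale t x"]) simp_all
qed

lemma dim_UNIV_eq_card:
  fixes b :: "'n::finite \<Rightarrow> 'v"
  assumes "bij (lincomb b)"
  shows "dim UNIV = CARD('n)"
proof -
  have b: "inj b" "independent (range b)"
    using assms inj_lincomb_imp_inj inj_lincomb_imp_independent bij_is_inj by blast+
  have "span (range b) = UNIV" using range_lincomb[OF b(1)] assms by (simp add: bij_is_surj)
  then have "dim UNIV = card (range b)" using b by (intro dim_eq_card) auto
  then show ?thesis using b by (simp add: card_image)
qed

end

sublocale leibniz_algebra \<subseteq> coordinate_space scale
  by unfold_locales

section \<open>Structure constants\<close>

context leibniz_algebra
begin

lemmas bracket_add_right = module_hom.add[OF Vector_Spaces.linear.axioms(3)[OF linear_right]]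
lemmas bracket_add_left = module_hom.add[OF Vector_Spaces.linear.axioms(3)[OF linear_left]]
lemmas bracket_scale_right = module_hom.scale[OF Vector_Spaces.linear.axioms(3)[OF linear_right]]
lemmas bracket_scale_left = module_hom.scale[OF Vector_Spaces.linear.axioms(3)[OF linear_left]]
lemmas bracket_zero_left = module_hom.zero[OF Vector_Spaces.linear.axioms(3)[OF linear_left]]
lemmas bracket_sum_right = module_hom.sum[OF Vector_Spaces.linear.axioms(3)[OF linear_right]]
lemmas bracket_sum_left = module_hom.sum[OF Vector_Spaces.linear.axioms(3)[OF linear_left]]

lemma lincomb_table_bracket:
  assumes "\<And>i j. lincomb b (c i j) = bracket (b i) (b j)"
  shows "lincomb b (table_bracket c u v) = bracket (lincomb b u) (lincomb b v)"
proof -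
  have "lincomb b (table_bracket c u v)
      = (\<Sum>i\<in>UNIV. \<Sum>j\<in>UNIV. scale (u $ i * v $ j) (bracket (b i) (b j)))"
    by (simp add: table_bracket_def lincomb_sum lincomb_scale assms)
  also have "\<dots> = (\<Sum>j\<in>UNIV. \<Sum>i\<in>UNIV. scale (v $ j * u $ i) (bracket (b i) (b j)))"
    by (subst sum.swap) (simp add: mult.commute)
  also have "\<dots> = bracket (lincomb b u) (lincomb b v)"
    by (simp add: lincomb_def bracket_sum_left bracket_sum_right bracket_scale_left
        bracket_scale_right scale_sum_right)
  finally show ?thesis .
qed

lemma algebra_isomorphic_table:
  assumes "bij (lincomb b)" and "\<And>i j. lincomb b (c i j) = bracket (b i) (b j)"
  shows "algebra_isomorphic scale bracket UNIV (*s) (table_bracket c) UNIV"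
proof -
  let ?g = "lincomb b"
  let ?f = "inv ?g"
  have fg: "?f (?g v) = v" for v using assms(1) by (simp add: bij_is_inj)
  have gf: "?g (?f y) = y" for y using assms(1) by (simp add: bij_is_surj surj_f_inv_f)
  show ?thesis unfolding algebra_isomorphic_def
  proof (intro exI[of _ ?f] conjI ballI allI)
    show "bij ?f" using assms(1) by (rule bij_imp_bij_inv)
    fix y z c'
    show "?f (y + z) = ?f y + ?f z" using fg[of "?f y + ?f z"] by (simp add: lincomb_add gf)
    show "?f (scale c' y) = c' *s ?f y" using fg[of "c' *s ?f y"] by (simp add: lincomb_scale gf)
    show "?f (bracket y z) = table_bracket c (?f y) (?f z)"
      using fg[of "table_bracket c (?f y) (?f z)"]
      by (simp add: lincomb_table_bracket[OF assms(2)] gf)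
  qed
qed

text \<open>The vectors \<open>b i\<close> are the preimages in \<open>N\<close> of the standard basis vectors: an isomorphism onto a
  coordinate space is inverse to the coordinate map of such a family.\<close>

lemma table_basis_of_isomorphic:
  fixes c :: "'n::finite \<Rightarrow> 'n \<Rightarrow> complex ^ 'n"
  assumes "two_sided_ideal N" and "algebra_isomorphic scale bracket N (*s) (table_bracket c) UNIV"
  obtains b where "inj (lincomb b)" "range (lincomb b) = N"
    "\<And>u v. bracket (lincomb b u) (lincomb b v) = lincomb b (table_bracket c u v)"
proof -
  have sub: "subspace N" using assms(1) by (simp add: two_sided_ideal_def)
  obtain f where bij: "bij_betw f N UNIV"
    and add: "\<And>x y. x \<in> N \<Longrightarrow> y \<in> N \<Longrightarrow> f (x + y) = f x + f y"
    and scl: "\<And>k x. x \<in> N \<Longrightarrow> f (scale k x) = k *s f x"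
    and br: "\<And>x y. x \<in> N \<Longrightarrow> y \<in> N \<Longrightarrow> f (bracket x y) = table_bracket c (f x) (f y)"
    using assms(2) unfolding algebra_isomorphic_def by blast
  define b where "b i = inv_into N f (axis i 1)" for i :: 'n
  have b: "b i \<in> N" "f (b i) = axis i 1" for i
    using bij by (auto simp: b_def bij_betw_def inv_into_into f_inv_into_f)
  have f0: "f 0 = 0" using scl[OF b(1), of 0 undefined] by simp
  have fsum: "(\<Sum>i\<in>A. g i) \<in> N \<and> f (\<Sum>i\<in>A. g i) = (\<Sum>i\<in>A. f (g i))"
    if "\<And>i. g i \<in> N" for A :: "'n set" and g
    using finite[of A]
    by (induction A rule: finite_induct)
       (auto simp: f0 add that sub subspace_0 subspace_add)
  have N: "lincomb b v \<in> N" for v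
    unfolding lincomb_def using fsum[of "\<lambda>i. scale (v $ i) (b i)" UNIV] b sub
    by (simp add: subspace_scale)
  have fl: "f (lincomb b v) = v" for v
  proof -
    have "f (lincomb b v) = (\<Sum>i\<in>UNIV. v $ i *s axis i 1)"
      unfolding lincomb_def using fsum[of "\<lambda>i. scale (v $ i) (b i)" UNIV] b sub
      by (simp add: subspace_scale scl)
    then show ?thesis by (simp add: basis_expansion)
  qed
  have lf: "lincomb b (f y) = y" if "y \<in> N" for y
    using bij fl[of "f y"] N that by (auto simp: bij_betw_def inj_on_def)
  show thesis
  proof
    show "inj (lincomb b)" by (metis fl injI)
    show "range (lincomb b) = N" using N lf by (metis rangeI subsetI image_subsetI subset_antisym)
    show "bracket (lincomb b u) (lincomb b v) = lincomb b (table_bracket c u v)" for u v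
    proof -
      have "bracket (lincomb b u) (lincomb b v) \<in> N" using assms(1) N by (simp add: two_sided_ideal_def)
      then show ?thesis using br[OF N N, of u v] lf by (metis fl)
    qed
  qed
qed

end

section \<open>One-dimensional extensions of the null-filiform algebra\<close>

text \<open>The ideal is given through its coordinate map \<open>lincomb e\<close>, so that membership in it and
  equality of its elements become statements about three coefficients.\<close>

locale lambda6_extension = leibniz_algebra scale bracket
  for scale :: "complex \<Rightarrow> 'a::ab_group_add \<Rightarrow> 'a" and bracket +
  fixes e :: "3 \<Rightarrow> 'a" and x :: 'a
  assumes inj_e: "inj (lincomb e)"
    and bracket_e: "bracket (lincomb e u) (lincomb e v) = lincomb e (lambda6_bracket u v)"
    and ideal: "two_sided_ideal (range (lincomb e))"
    and x_notin: "x \<notin> range (lincomb e)"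
    and x_spans: "\<exists>t. \<exists>n\<in>range (lincomb e). y = scale t x + n"
begin

definition ncomb :: "complex \<Rightarrow> complex \<Rightarrow> complex \<Rightarrow> 'a"
  where "ncomb a b c = lincomb e (vector [a, b, c])"

lemma ncomb_arith:
  "ncomb a b c + ncomb a' b' c' = ncomb (a + a') (b + b') (c + c')"
  "ncomb a b c - ncomb a' b' c' = ncomb (a - a') (b - b') (c - c')"
  "- ncomb a b c = ncomb (- a) (- b) (- c)"
  "scale k (ncomb a b c) = ncomb (k * a) (k * b) (k * c)"
proof -
  have add: "ncomb a b c + ncomb a' b' c' = ncomb (a + a') (b + b') (c + c')" for a b c a' b' c'
    unfolding ncomb_def lincomb_add[symmetric]
    by (rule arg_cong[of _ _ "lincomb e"]) (simp add: vec_eq_iff forall_3)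
  have scl: "scale k (ncomb a b c) = ncomb (k * a) (k * b) (k * c)" for k a b c
    unfolding ncomb_def lincomb_scale[symmetric]
    by (rule arg_cong[of _ _ "lincomb e"]) (simp add: vec_eq_iff forall_3)
  have minus: "- ncomb a b c = ncomb (- a) (- b) (- c)" for a b c
    using scl[of "-1" a b c] by simp
  show "ncomb a b c + ncomb a' b' c' = ncomb (a + a') (b + b') (c + c')"
    "- ncomb a b c = ncomb (- a) (- b) (- c)"
    "scale k (ncomb a b c) = ncomb (k * a) (k * b) (k * c)"
    by (rule add minus scl)+
  show "ncomb a b c - ncomb a' b' c' = ncomb (a - a') (b - b') (c - c')"
    using add[of a b c "- a'" "- b'" "- c'"] by (simp add: minus[symmetric])
qed

lemma ncomb_zero: "ncomb 0 0 0 = 0"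
  using ncomb_arith(4)[of 0 0 0 0] by simp

lemma ncomb_eq_iff: "ncomb a b c = ncomb a' b' c' \<longleftrightarrow> a = a' \<and> b = b' \<and> c = c'"
  using inj_e by (auto simp: ncomb_def inj_eq vec_eq_iff forall_3)

lemma ncomb_eq_0_iff: "ncomb a b c = 0 \<longleftrightarrow> a = 0 \<and> b = 0 \<and> c = 0"
  using ncomb_eq_iff[of a b c 0 0 0] by (simp add: ncomb_zero)

lemma range_lincomb_e: "range (lincomb e) = {ncomb a b c | a b c. True}"
proof -
  have "lincomb e v = ncomb (v $ 1) (v $ 2) (v $ 3)" for v
    unfolding ncomb_def by (rule arg_cong[of _ _ "lincomb e"]) (simp add: vec_eq_iff forall_3)
  then show ?thesis by (auto simp: ncomb_def)
qed

lemma bracket_ncomb: "bracket (ncomb a b c) (ncomb a' b' c') = ncomb 0 (a * a') (b * a')"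
  unfolding ncomb_def bracket_e
  by (rule arg_cong[of _ _ "lincomb e"])
     (simp add: vec_eq_iff forall_3 lambda6_bracket_def table_bracket_def sum_3 lambda6_table_def
        axis_def)

lemma ncomb_split: "ncomb a b c = scale a (ncomb 1 0 0) + scale b (ncomb 0 1 0) + scale c (ncomb 0 0 1)"
  by (simp add: ncomb_arith)

lemmas bilinear = bracket_add_left bracket_add_right bracket_scale_left bracket_scale_right

lemma decompose:
  obtains t a b c where "y = scale t x + ncomb a b c"
  using x_spans[of y] unfolding range_lincomb_e by blast

lemma scale_x_eq_ncomb:
  assumes "scale t x + ncomb a b c = ncomb a' b' c'"
  shows "t = 0"
proof (rule ccontr)
  assume t: "t \<noteq> 0"
  have "scale t x = ncomb (a' - a) (b' - b) (c' - c)"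
    using assms by (simp add: ncomb_arith(2)[symmetric] algebra_simps)
  then have "x = scale (1 / t) (ncomb (a' - a) (b' - b) (c' - c))"
    using t by (metis divide_self_if scale_one scale_scale times_divide_eq_left mult_1)
  then show False using x_notin by (auto simp: ncomb_arith range_lincomb_e)
qed

text \<open>The Leibniz identity, read as \<open>[[y, z], x] = [y, [z, x]] + [[y, x], z]\<close>, propagates the action
  of \<open>x\<close> from \<open>e\<^sub>1\<close> to \<open>e\<^sub>2 = [e\<^sub>1, e\<^sub>1]\<close> and \<open>e\<^sub>3 = [e\<^sub>2, e\<^sub>1]\<close>. The coefficient of \<open>[x, e\<^sub>1]\<close> along \<open>e\<^sub>1\<close>
  and the shape of \<open>[x, x]\<close> come from elements \<open>[y, z] + [z, y]\<close> and \<open>[y, y]\<close> being annihilated by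
  every left multiplication: \<open>e\<^sub>1\<close> and \<open>x\<close> detect the coefficients along \<open>e\<^sub>1\<close> and \<open>x\<close>.\<close>

lemma action_of_x:
  obtains a p q r s c d where
    "\<And>u v w. bracket (ncomb u v w) x = ncomb (a * u) (p * u + 2 * a * v) (q * u + p * v + 3 * a * w)"
    "\<And>u v w. bracket x (ncomb u v w) = ncomb (- a * u) (r * u) (s * u)"
    "bracket x x = ncomb 0 c d"
proof -
  have inN: "\<exists>a b c. bracket (ncomb u v w) y = ncomb a b c"
    "\<exists>a b c. bracket y (ncomb u v w) = ncomb a b c" for u v w y
    using ideal unfolding two_sided_ideal_def range_lincomb_e by blast+
  obtain a p q where e1x: "bracket (ncomb 1 0 0) x = ncomb a p q" using inN by metis
  obtain a' r s where xe1: "bracket x (ncomb 1 0 0) = ncomb a' r s" using inN by metis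
  have e2: "ncomb 0 1 0 = bracket (ncomb 1 0 0) (ncomb 1 0 0)"
    and e3: "ncomb 0 0 1 = bracket (ncomb 0 1 0) (ncomb 1 0 0)"
    by (simp_all add: bracket_ncomb)
  have der: "bracket (bracket y z) x = bracket y (bracket z x) + bracket (bracket y x) z" for y z
    using leibniz[of y z x] by simp
  have e2x: "bracket (ncomb 0 1 0) x = ncomb 0 (2 * a) p"
    unfolding e2 der e1x by (simp add: bracket_ncomb ncomb_arith)
  have e3x: "bracket (ncomb 0 0 1) x = ncomb 0 0 (3 * a)"
    unfolding e3 der e1x e2x by (simp add: bracket_ncomb ncomb_arith)
  have xe2: "bracket x (ncomb 0 1 0) = 0"
    unfolding e2 leibniz by simp
  have xe3: "bracket x (ncomb 0 0 1) = 0"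
    unfolding e3 leibniz xe2 xe1 by (simp add: bracket_ncomb bracket_zero_left ncomb_zero)
  have right: "bracket (ncomb u v w) x
      = ncomb (a * u) (p * u + 2 * a * v) (q * u + p * v + 3 * a * w)" for u v w
    by (subst ncomb_split, simp only: bilinear e1x e2x e3x) (simp add: ncomb_arith algebra_simps)
  \<comment> \<open>Left multiplication by \<open>e\<^sub>1\<close> annihilates \<open>[x, e\<^sub>1] + [e\<^sub>1, x]\<close>.\<close>
  have "bracket (ncomb 1 0 0) (bracket x (ncomb 1 0 0)) + bracket (ncomb 1 0 0) (bracket (ncomb 1 0 0) x) = 0"
    by (simp add: leibniz)
  then have "a' = - a"
    by (simp add: xe1 e1x bracket_ncomb ncomb_arith ncomb_eq_0_iff add_eq_0_iff)
  then have left: "bracket x (ncomb u v w) = ncomb (- a * u) (r * u) (s * u)" for u v w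
    by (subst ncomb_split, simp only: bilinear xe1 xe2 xe3) (simp add: ncomb_arith mult.commute)
  obtain t c1 c d where xx: "bracket x x = scale t x + ncomb c1 c d" by (rule decompose)
  \<comment> \<open>Modulo the ideal, \<open>[x, x] = t x\<close> and so \<open>0 = [x, [x, x]] = t\<^sup>2 x\<close>.\<close>
  have "bracket x (bracket x x) = 0" by (simp add: leibniz)
  then have "scale (t * t) x + ncomb (t * c1 - a * c1) (t * c + r * c1) (t * d + s * c1) = ncomb 0 0 0"
    unfolding xx by (simp add: bilinear left xx ncomb_arith ncomb_zero scale_right_distrib add.assoc)
  from scale_x_eq_ncomb[OF this] have "t = 0" by simp
  then have xx: "bracket x x = ncomb c1 c d" using xx by simp
  have "bracket (ncomb 1 0 0) (bracket x x) = 0" by (simp add: leibniz)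
  then have "c1 = 0" by (simp add: xx bracket_ncomb ncomb_eq_0_iff)
  with right left xx that show thesis by blast
qed

lemma subspace_ncomb: "subspace {ncomb 0 b c | b c. True}" "subspace {ncomb 0 0 c | c. True}"
  by (force simp: subspace_def ncomb_arith ncomb_zero[symmetric] ncomb_eq_iff)+

text \<open>These are the relations of \<open>action_of_x\<close> with \<open>a = 0\<close>. Right multiplications then move strictly
  down the flag formed by the whole algebra, the span of \<open>e\<^sub>2, e\<^sub>3\<close>, the span of \<open>e\<^sub>3\<close>, and \<open>0\<close>.\<close>

lemma nilpotent_UNIV:
  assumes right: "\<And>u v w. bracket (ncomb u v w) x = ncomb 0 (p * u) (q * u + p * v)"
    and left: "\<And>u v w. bracket x (ncomb u v w) = ncomb 0 (r * u) (s * u)"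
    and xx: "bracket x x = ncomb 0 c d"
  shows "nilpotent UNIV"
proof -
  have step: "bracket_space A UNIV \<subseteq> B"
    if "subspace B" "\<And>y t a b c. y \<in> A \<Longrightarrow> bracket y (scale t x + ncomb a b c) \<in> B" for A B
  proof -
    have "bracket y z \<in> B" if "y \<in> A" for y z
      using \<open>\<And>y t a b c. y \<in> A \<Longrightarrow> bracket y (scale t x + ncomb a b c) \<in> B\<close>[OF that]
      by (metis decompose[of z])
    then show ?thesis unfolding bracket_space_def by (intro span_minimal that(1)) auto
  qed
  have mono: "bracket_space A UNIV \<subseteq> bracket_space B UNIV" if "A \<subseteq> B" for A B
    unfolding bracket_space_def using that by (intro span_mono) auto
  let ?A = "{ncomb 0 b c | b c. True}" and ?B = "{ncomb 0 0 c | c. True}"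
  have 1: "bracket_space UNIV UNIV \<subseteq> ?A"
  proof (rule step[OF subspace_ncomb(1)])
    fix y t a b c
    show "bracket y (scale t x + ncomb a b c) \<in> ?A"
      by (rule decompose[of y]) (auto simp: bilinear right left xx bracket_ncomb ncomb_arith)
  qed
  have 2: "bracket_space ?A UNIV \<subseteq> ?B"
    by (rule step[OF subspace_ncomb(2)]) (auto simp: bilinear right bracket_ncomb ncomb_arith)
  have 3: "bracket_space ?B UNIV \<subseteq> {0}"
    by (rule step[OF subspace_single_0])
       (auto simp: bilinear right bracket_ncomb ncomb_arith ncomb_zero)
  have "lower_central UNIV (Suc (Suc (Suc 0))) \<subseteq> {0}"
    using mono[OF mono[OF 1]] mono[OF 2] 3 by auto
  moreover have "0 \<in> lower_central UNIV (Suc (Suc (Suc 0)))"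
    by (simp add: bracket_space_def span_zero)
  ultimately show ?thesis unfolding nilpotent_def by blast
qed

text \<open>Non-nilpotency makes the eigenvalue \<open>a\<close> nonzero, and all remaining structure constants can then
  be normalised by triangular changes of basis.\<close>

lemma adapted_basis:
  assumes "\<not> nilpotent UNIV"
  obtains b :: "4 \<Rightarrow> 'a" where "inj (lincomb b)"
    "\<And>i j. lincomb b (L43_table i j) = bracket (b i) (b j)"
proof -
  obtain a p q r s c d where
    right: "\<And>u v w. bracket (ncomb u v w) x = ncomb (a * u) (p * u + 2 * a * v) (q * u + p * v + 3 * a * w)"
    and left: "\<And>u v w. bracket x (ncomb u v w) = ncomb (- a * u) (r * u) (s * u)"
    and xx: "bracket x x = ncomb 0 c d"
    by (rule action_of_x) blast
  have a: "a \<noteq> 0"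
  proof
    assume "a = 0"
    then have "nilpotent UNIV" using right left xx by (intro nilpotent_UNIV[of p q r s c d]) simp_all
    then show False using assms by simp
  qed
  \<comment> \<open>The coefficients solve \<open>[f, x] = a f\<close> for \<open>f = e\<^sub>1 + \<alpha> e\<^sub>2 + \<beta> e\<^sub>3\<close>; this is triangular, with
    pivots \<open>a - 2a\<close> and \<open>a - 3a\<close>.\<close>
  define \<alpha> \<beta> where "\<alpha> = - p / a" and "\<beta> = - (q + \<alpha> * p) / (2 * a)"
  have eig: "p + 2 * a * \<alpha> = a * \<alpha>" "q + p * \<alpha> + 3 * a * \<beta> = a * \<beta>"
    using a by (simp_all add: \<alpha>_def \<beta>_def field_simps)
  \<comment> \<open>The deviation of \<open>[x, f]\<close> from \<open>- a f\<close>.\<close>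
  define R S where "R = r + a * \<alpha>" and "S = s + a * \<beta>"
  have f1x: "bracket (ncomb 1 \<alpha> \<beta>) x = ncomb a (a * \<alpha>) (a * \<beta>)"
    by (simp add: right eig)
  have xf1: "bracket x (ncomb 1 \<alpha> \<beta>) = ncomb (- a) (- a * \<alpha> + R) (- a * \<beta> + S)"
    by (simp add: left R_def S_def)
  have "scale a (bracket x (ncomb 1 \<alpha> \<beta>)) = bracket x (bracket (ncomb 1 \<alpha> \<beta>) x)"
    by (simp add: f1x bracket_scale_right[symmetric] ncomb_arith)
  also have "\<dots> = bracket (bracket x (ncomb 1 \<alpha> \<beta>)) x - bracket (bracket x x) (ncomb 1 \<alpha> \<beta>)"
    by (rule leibniz)
  finally have "a * (- a * \<alpha> + R) = p * - a + 2 * a * (- a * \<alpha> + R)"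
    "a * (- a * \<beta> + S) = q * - a + p * (- a * \<alpha> + R) + 3 * a * (- a * \<beta> + S) - c"
    unfolding xf1 by (simp_all add: right xx bracket_ncomb ncomb_arith ncomb_eq_iff)
  then have "a * R = 0" "a * S = p * R + 3 * a * S - c" using eig by algebra+
  then have R: "R = 0" and c: "c = 2 * a * S" using a by (simp_all add: algebra_simps)
  \<comment> \<open>Adding \<open>P e\<^sub>2\<close> changes \<open>[x / a, f]\<close> by \<open>P e\<^sub>3\<close>, which fixes \<open>P\<close>. Because \<open>c = 2 a S\<close>, the same
    \<open>P\<close> removes the \<open>e\<^sub>2\<close>-coefficient of \<open>[x', x']\<close>; \<open>Q\<close> is chosen to remove its \<open>e\<^sub>3\<close>-coefficient.\<close>
  define P Q where "P = - S / a" and "Q = - (d / a\<^sup>2 + p * P / a) / 3"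
  define x' where "x' = scale (1 / a) x + ncomb 0 P Q"
  have rightx': "bracket (ncomb u v w) x' = scale (1 / a) (bracket (ncomb u v w) x)" for u v w
    by (simp add: x'_def bilinear bracket_ncomb ncomb_zero)
  have x'f1: "bracket x' (ncomb 1 \<alpha> \<beta>) = - ncomb 1 \<alpha> \<beta>"
    using a by (simp add: x'_def bilinear bracket_ncomb xf1 ncomb_arith ncomb_eq_iff R P_def
        field_simps)
  have x'x': "bracket x' x' = 0"
    using a by (simp add: x'_def bilinear bracket_ncomb xx left right ncomb_arith ncomb_eq_0_iff
        c P_def Q_def field_simps power2_eq_square)
  have f2x: "bracket (ncomb 0 1 \<alpha>) x = ncomb 0 (2 * a) (2 * a * \<alpha>)"
  proof -
    have "p + 3 * a * \<alpha> = 2 * a * \<alpha>" using eig(1) by algebra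
    then show ?thesis by (simp add: right ncomb_eq_iff)
  qed
  have f3x: "bracket (ncomb 0 0 1) x = ncomb 0 0 (3 * a)"
    by (simp add: right)
  have x'f23: "bracket x' (ncomb 0 v w) = 0" for v w
    by (simp add: x'_def bilinear bracket_ncomb left ncomb_arith ncomb_zero)
  define b :: "4 \<Rightarrow> 'a" where "b i =
    (if i = 1 then ncomb 1 \<alpha> \<beta> else if i = 2 then ncomb 0 1 \<alpha>
     else if i = 3 then ncomb 0 0 1 else x')" for i
  have b: "b 1 = ncomb 1 \<alpha> \<beta>" "b 2 = ncomb 0 1 \<alpha>" "b 3 = ncomb 0 0 1" "b 4 = x'"
    by (simp_all add: b_def)
  have lincomb_b: "lincomb b v = scale (v $ 4 / a) x + ncomb (v $ 1)
      (v $ 1 * \<alpha> + v $ 2 + v $ 4 * P) (v $ 1 * \<beta> + v $ 2 * \<alpha> + v $ 3 + v $ 4 * Q)" for v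
  proof -
    have "lincomb b v = ncomb (v $ 1) (v $ 1 * \<alpha> + v $ 2) (v $ 1 * \<beta> + v $ 2 * \<alpha> + v $ 3)
        + (scale (v $ 4 / a) x + ncomb 0 (v $ 4 * P) (v $ 4 * Q))"
      by (simp add: lincomb_def sum_4 b x'_def scale_right_distrib ncomb_arith)
    then show ?thesis by (simp only: add.left_commute ncomb_arith) simp
  qed
  show thesis
  proof (rule that)
    show "inj (lincomb b)"
    proof (rule inj_lincombI)
      fix v assume v: "lincomb b v = 0"
      then have "v $ 4 / a = 0" unfolding lincomb_b ncomb_zero[symmetric] by (rule scale_x_eq_ncomb)
      then have "v $ 4 = 0" using a by simp
      with v show "v = 0" by (auto simp: lincomb_b ncomb_eq_0_iff vec_eq_iff forall_4)
    qed
    have table: "\<forall>i j. lincomb b (L43_table i j) = bracket (b i) (b j)"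
      unfolding forall_4
      using a by (simp add: L43_table_def lincomb_axis lincomb_scale lincomb_minus lincomb_zero b
         bracket_ncomb rightx' x'f1 x'x' x'f23 f1x f2x f3x ncomb_arith ncomb_zero)
    show "lincomb b (L43_table i j) = bracket (b i) (b j)" for i j
      using table by blast
  qed
qed

end

theorem proposition3p12:
  fixes scale :: "complex \<Rightarrow> 'a::ab_group_add \<Rightarrow> 'a"
    and bracket :: "'a \<Rightarrow> 'a \<Rightarrow> 'a"
    and N :: "'a set"
  assumes "leibniz_algebra scale bracket"
    and "vector_space.dim scale (UNIV :: 'a set) = 4"
    and "leibniz_algebra.solvable scale bracket UNIV"
    and "leibniz_algebra.is_nilradical scale bracket N"
    and "algebra_isomorphic scale bracket N (*s) lambda6_bracket (UNIV :: (complex ^ 3) set)"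
  shows "algebra_isomorphic scale bracket UNIV (*s) L43_bracket (UNIV :: (complex ^ 4) set)"
proof -
  interpret leibniz_algebra scale bracket by (rule assms(1))
  have ideal: "two_sided_ideal N"
    and max: "\<And>M. two_sided_ideal M \<Longrightarrow> nilpotent M \<Longrightarrow> N \<subseteq> M \<Longrightarrow> M = N"
    using assms(4) by (auto simp: is_nilradical_def)
  obtain e :: "3 \<Rightarrow> 'a" where e: "inj (lincomb e)" "range (lincomb e) = N"
    "\<And>u v. bracket (lincomb e u) (lincomb e v) = lincomb e (lambda6_bracket u v)"
    using table_basis_of_isomorphic[OF ideal assms(5)[unfolded lambda6_bracket_def]]
    unfolding lambda6_bracket_def by blast
  have "N \<noteq> UNIV"
    using dim_UNIV_eq_card[of e] e assms(2) by (auto simp: bij_def)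
  then obtain x where x: "x \<notin> N" by blast
  interpret lambda6_extension scale bracket e x
  proof unfold_locales
    show "\<exists>t. \<exists>n\<in>range (lincomb e). y = scale t x + n" for y
      using e x assms(2) by (intro ex_scale_add_range_lincomb) simp_all
  qed (simp_all add: e ideal x)
  have "\<not> nilpotent UNIV"
    using max[of UNIV] \<open>N \<noteq> UNIV\<close> by (auto simp: two_sided_ideal_def)
  then obtain b :: "4 \<Rightarrow> 'a" where b: "inj (lincomb b)"
    "\<And>i j. lincomb b (L43_table i j) = bracket (b i) (b j)"
    by (rule adapted_basis) (rule that)
  have "bij (lincomb b)" using b(1) assms(2) by (intro bij_lincomb) simp_all
  then show ?thesis
    unfolding L43_bracket_def by (rule algebra_isomorphic_table) (rule b(2))
qed

end
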